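(* Let $\mathcal{H}$ be a complex Hilbert space, let $A\in\mathcal{B}(\mathcal{H})$ be a positive operator, and let $T\in\mathcal{B}_A(\mathcal{H})$. Then for all $\alpha\in[0,1]$, $$w_A^2(T)\le \frac{\alpha}{2}\,w_A(T^2)+\left\|\frac{\alpha}{4}\,TT^{\sharp_A}+\left(1-\frac{3\alpha}{4}\right)T^{\sharp_A}T\right\|_A$$ and $$w_A^2(T)\le \frac{\alpha}{2}\,w_A(T^2)+\left\|\left(1-\frac{3\alpha}{4}\right)TT^{\sharp_A}+\frac{\alpha}{4}\,T^{\sharp_A}T\right\|_A .$$
   Context: $\mathcal{H}$ is a complex Hilbert space with inner product $\langle\cdot,\cdot\rangle$ (linear in the first variable), $\mathcal{B}(\mathcal{H})$ is the algebra of bounded linear operators on $\mathcal{H}$, and $A\in\mathcal{B}(\mathcal{H})$ is a positive operator (i.e. $\langle Ax,x\rangle\ge 0$ for all $x$; not necessarily injective or with closed range). Put $\langle x,y\rangle_A=\langle Ax,y\rangle$ and $\|x\|_A=\sqrt{\langle x,x\rangle_A}$. An operator $R\in\mathcal{B}(\mathcal{H})$ is an $A$-adjoint of $T\in\mathcal{B}(\mathcal{H})$ if $\langle Tx,y\rangle_A=\langle x,Ry\rangle_A$ for all $x,y\in\mathcal{H}$. $\mathcal{B}_A(\mathcal{H})$ is the set of all $T\in\mathcal{B}(\mathcal{H})$ admitting an $A$-adjoint; equivalently, $R(T^*A)\subseteq R(A)$, where $R(\cdot)$ denotes range. For $T\in\mathcal{B}_A(\mathcal{H})$, $T^{\sharp_A}$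 denotes the unique $A$-adjoint with range contained in $\overline{R(A)}$, i.e. the unique solution $X$ of $AX=T^*A$ with $R(X)\subseteq\overline{R(A)}$. For $T\in\mathcal{B}_A(\mathcal{H})$, the $A$-operator seminorm is $\|T\|_A=\sup\{\|Tx\|_A: x\in\mathcal{H},\ \|x\|_A=1\}$ and the $A$-numerical radius is $w_A(T)=\sup\{|\langle Tx,x\rangle_A|: x\in\mathcal{H},\ \|x\|_A=1\}$. Write $w_A^2(T)=(w_A(T))^2$. *)

theory Defs
  imports "HOL-Analysis.Analysis"
begin

text \<open>Complex inner product spaces, with the inner product linear in the first variable.
  The norm, the topology and the real scalar multiplication are those of
  \<^class>\<open>real_normed_vector\<close>; the axioms \<open>scaleR_scaleC\<close> and
  \<open>norm_eq_sqrt_cinner\<close> tie them to the complex structure. The latter also makes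
  the inner product definite.\<close>

class complex_inner = real_normed_vector +
  fixes scaleC :: "complex \<Rightarrow> 'a \<Rightarrow> 'a"  (infixr \<open>*\<^sub>C\<close> 75)
    and cinner :: "'a \<Rightarrow> 'a \<Rightarrow> complex"
  assumes scaleC_add_right: "c *\<^sub>C (x + y) = c *\<^sub>C x + c *\<^sub>C y"
    and scaleC_add_left: "(c + d) *\<^sub>C x = c *\<^sub>C x + d *\<^sub>C x"
    and scaleC_scaleC: "c *\<^sub>C (d *\<^sub>C x) = (c * d) *\<^sub>C x"
    and scaleR_scaleC: "r *\<^sub>R x = complex_of_real r *\<^sub>C x"
    and cinner_commute: "cinner x y = cnj (cinner y x)"
    and cinner_add_left: "cinner (x + y) z = cinner x z + cinner y z"
    and cinner_scaleC_left: "cinner (c *\<^sub>C x) y = c * cinner x y"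
    and cinner_self_nonneg: "cinner x x \<in> \<real>\<^sub>\<ge>\<^sub>0"
    and norm_eq_sqrt_cinner: "norm x = sqrt (Re (cinner x x))"

class chilbert_space = complex_inner + complete_space

instantiation complex :: chilbert_space
begin

definition scaleC_complex :: "complex \<Rightarrow> complex \<Rightarrow> complex" where
  "scaleC_complex c x = c * x"

definition cinner_complex :: "complex \<Rightarrow> complex \<Rightarrow> complex" where
  "cinner_complex x y = x * cnj y"

instance
  by standard
    (auto simp: scaleC_complex_def cinner_complex_def algebra_simps scaleR_conv_of_real
      complex_nonneg_Reals_iff cmod_def power2_eq_square)

end

definition bounded_clinear :: "('a::complex_inner \<Rightarrow> 'a) \<Rightarrow> bool" where
  "bounded_clinear T \<longleftrightarrow> bounded_linear T \<and> (\<forall>c x. T (c *\<^sub>C x) = c *\<^sub>C T x)"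

definition positive_op :: "('a::complex_inner \<Rightarrow> 'a) \<Rightarrow> bool" where
  "positive_op A \<longleftrightarrow> bounded_clinear A \<and> (\<forall>x. cinner (A x) x \<in> \<real>\<^sub>\<ge>\<^sub>0)"

definition A_inner :: "('a::complex_inner \<Rightarrow> 'a) \<Rightarrow> 'a \<Rightarrow> 'a \<Rightarrow> complex" where
  "A_inner A x y = cinner (A x) y"

definition A_norm :: "('a::complex_inner \<Rightarrow> 'a) \<Rightarrow> 'a \<Rightarrow> real" where
  "A_norm A x = sqrt (Re (A_inner A x x))"

definition is_A_adjoint ::
    "('a::complex_inner \<Rightarrow> 'a) \<Rightarrow> ('a \<Rightarrow> 'a) \<Rightarrow> ('a \<Rightarrow> 'a) \<Rightarrow> bool" where
  "is_A_adjoint A T R \<longleftrightarrow>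
     bounded_clinear R \<and> (\<forall>x y. A_inner A (T x) y = A_inner A x (R y))"

definition A_adjointable :: "('a::complex_inner \<Rightarrow> 'a) \<Rightarrow> ('a \<Rightarrow> 'a) set" where
  "A_adjointable A = {T. bounded_clinear T \<and> (\<exists>R. is_A_adjoint A T R)}"

text \<open>For positive \<open>A\<close> on a Hilbert space and \<open>T \<in> A_adjointable A\<close> the operator described
  here exists and is unique.\<close>

definition A_sharp :: "('a::complex_inner \<Rightarrow> 'a) \<Rightarrow> ('a \<Rightarrow> 'a) \<Rightarrow> ('a \<Rightarrow> 'a)" where
  "A_sharp A T = (THE R. is_A_adjoint A T R \<and> range R \<subseteq> closure (range A))"

text \<open>For \<open>T \<in> A_adjointable A\<close> both suprema below are over bounded sets of nonnegative reals.
  For positive \<open>A\<close> the \<open>A\<close>-unit sphere is empty exactly when \<open>A = 0\<close>; there the supremum, taken in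
  \<open>[0, \<infinity>)\<close>, is \<open>0\<close>, whereas \<^const>\<open>Sup\<close> on \<^typ>\<open>real\<close> leaves it unspecified.\<close>

definition A_sphere :: "('a::complex_inner \<Rightarrow> 'a) \<Rightarrow> 'a set" where
  "A_sphere A = {x. A_norm A x = 1}"

definition A_opnorm :: "('a::complex_inner \<Rightarrow> 'a) \<Rightarrow> ('a \<Rightarrow> 'a) \<Rightarrow> real" where
  "A_opnorm A T =
     (if A_sphere A = {} then 0 else (SUP x\<in>A_sphere A. A_norm A (T x)))"

definition A_numradius :: "('a::complex_inner \<Rightarrow> 'a) \<Rightarrow> ('a \<Rightarrow> 'a) \<Rightarrow> real" where
  "A_numradius A T =
     (if A_sphere A = {} then 0 else (SUP x\<in>A_sphere A. cmod (A_inner A (T x) x)))"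

end

theory Submission
  imports Defs
begin

text \<open>Write $[x, y] = \langle Ax, y\rangle$ and let $S$ be an $A$-adjoint of $T$. For $[x,x] = 1$,
  Buzano's inequality applied to $Tx$, $x$, $Sx$ gives
  $2|[Tx,x]|^2 \le \|Tx\|_A \|Sx\|_A + |[T^2x,x]|$, hence
  $|[Tx,x]|^2 \le \frac14 [(TS + ST)x, x] + \frac12 |[T^2x,x]|$; the Cauchy--Schwarz inequality gives both
  $|[Tx,x]|^2 \le [STx,x]$ and $|[Tx,x]|^2 \le [TSx,x]$. The two bounds are convex
  combinations of these estimates. The suprema are finite because an $A$-adjointable operator
  is bounded for the $A$-seminorm, and $T^{\sharp_A}$ is obtained from any
  $A$-adjoint by projecting orthogonally onto $\overline{R(A)}$.\<close>

section \<open>The semi-inner product of a positive operator\<close>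

lemma bounded_clinear_add: "bounded_clinear T \<Longrightarrow> T (x + y) = T x + T y"
  by (simp add: bounded_clinear_def linear_simps)

lemma bounded_clinear_diff: "bounded_clinear T \<Longrightarrow> T (x - y) = T x - T y"
  by (simp add: bounded_clinear_def linear_simps)

lemma bounded_clinear_scaleC: "bounded_clinear T \<Longrightarrow> T (c *\<^sub>C x) = c *\<^sub>C T x"
  by (simp add: bounded_clinear_def)

lemma bounded_clinear_compose:
  assumes "bounded_clinear S" "bounded_clinear T"
  shows "bounded_clinear (\<lambda>x. S (T x))"
  using assms unfolding bounded_clinear_def by (auto intro: bounded_linear_compose)

lemma cinner_diff_left: "cinner (x - y) z = cinner x z - cinner y (z::'a::complex_inner)"
  by (metis add_diff_cancel_right' cinner_add_left diff_add_cancel)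

lemma cinner_add_right: "cinner x (y + z) = cinner x y + cinner x (z::'a::complex_inner)"
  by (metis cinner_add_left cinner_commute complex_cnj_add)

lemma cinner_scaleC_right: "cinner x (c *\<^sub>C y) = cnj c * cinner x (y::'a::complex_inner)"
  by (metis cinner_commute cinner_scaleC_left complex_cnj_mult)

text \<open>The identity is itself a positive operator, so everything proved for the seminorm
  specialises to the norm and inner product of the space. Cauchy-Schwarz there, and the
  parallelogram law behind the projection theorem, come this way.\<close>

lemma positive_op_id: "positive_op (\<lambda>x. x)"
  by (simp add: positive_op_def bounded_clinear_def cinner_self_nonneg bounded_linear_ident)

lemma A_inner_id: "A_inner (\<lambda>x. x) = cinner"
  by (simp add: A_inner_def fun_eq_iff)

lemma A_norm_id: "A_norm (\<lambda>x. x) x = norm x"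
  by (simp add: A_norm_def A_inner_id norm_eq_sqrt_cinner)

lemma positive_op_clinear: "positive_op A \<Longrightarrow> bounded_clinear A"
  by (simp add: positive_op_def)

lemma A_inner_add_left: "positive_op A \<Longrightarrow> A_inner A (x + y) z = A_inner A x z + A_inner A y z"
  by (simp add: A_inner_def positive_op_clinear bounded_clinear_add cinner_add_left)

lemma A_inner_diff_left: "positive_op A \<Longrightarrow> A_inner A (x - y) z = A_inner A x z - A_inner A y z"
  by (simp add: A_inner_def positive_op_clinear bounded_clinear_diff cinner_diff_left)

lemma A_inner_scaleC_left: "positive_op A \<Longrightarrow> A_inner A (c *\<^sub>C x) z = c * A_inner A x z"
  by (simp add: A_inner_def positive_op_clinear bounded_clinear_scaleC cinner_scaleC_left)

lemma A_inner_scaleR_left: "positive_op A \<Longrightarrow> A_inner A (r *\<^sub>R x) z = of_real r * A_inner A x z"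
  by (simp add: scaleR_scaleC A_inner_scaleC_left)

lemma A_inner_add_right: "A_inner A x (y + z) = A_inner A x y + A_inner A x z"
  by (simp add: A_inner_def cinner_add_right)

lemma A_inner_scaleC_right: "A_inner A x (c *\<^sub>C y) = cnj c * A_inner A x y"
  by (simp add: A_inner_def cinner_scaleC_right)

lemma A_inner_self:
  assumes "positive_op A"
  shows "A_inner A x x = of_real ((A_norm A x)\<^sup>2)"
proof -
  have "A_inner A x x \<in> \<real>\<^sub>\<ge>\<^sub>0"
    using assms by (simp add: positive_op_def A_inner_def)
  then have "Re (A_inner A x x) \<ge> 0" "Im (A_inner A x x) = 0"
    by (simp_all add: complex_nonneg_Reals_iff)
  then show ?thesis
    by (simp add: A_norm_def complex_eq_iff)
qed

lemma A_norm_nonneg [simp]: "positive_op A \<Longrightarrow> 0 \<le> A_norm A x"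
  by (simp add: A_norm_def A_inner_def positive_op_def complex_nonneg_Reals_iff)

text \<open>Positivity makes [z,z] real for every z. Over the complex scalars this already forces
  Hermitian symmetry: expanding at x + y compares the imaginary parts of [x,y] and [y,x], expanding
  at x + iy the real parts.\<close>

lemma A_inner_commute:
  assumes "positive_op A"
  shows "A_inner A x y = cnj (A_inner A y x)"
proof -
  have real: "Im (A_inner A z z) = 0" for z
    using assms by (simp add: A_inner_self)
  have "Im (A_inner A (x + y) (x + y)) = 0" "Im (A_inner A (x + \<i> *\<^sub>C y) (x + \<i> *\<^sub>C y)) = 0"
    by (simp_all only: real)
  then have "Im (A_inner A x y) + Im (A_inner A y x) = 0" "Re (A_inner A y x) = Re (A_inner A x y)"
    using assms
    by (simp_all add: A_inner_add_left A_inner_add_right A_inner_scaleC_left A_inner_scaleC_right real)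
  then show ?thesis
    by (simp add: complex_eq_iff)
qed

lemma A_inner_diff_right: "A_inner A x (y - z) = A_inner A x y - A_inner A x z"
  by (metis A_inner_add_right add_diff_cancel_right' diff_add_cancel)

lemma A_norm_diff_scaleC:
  assumes "positive_op A"
  shows "(A_norm A (x - c *\<^sub>C y))\<^sup>2
    = (A_norm A x)\<^sup>2 - 2 * Re (cnj c * A_inner A x y) + (cmod c)\<^sup>2 * (A_norm A y)\<^sup>2"
proof -
  have "A_inner A y x = cnj (A_inner A x y)"
    by (rule A_inner_commute[OF assms])
  then have "A_inner A (x - c *\<^sub>C y) (x - c *\<^sub>C y) = A_inner A x x
      - (cnj c * A_inner A x y + cnj (cnj c * A_inner A x y)) + (c * cnj c) * A_inner A y y"
    by (simp add: assms A_inner_diff_left A_inner_diff_right A_inner_scaleC_left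
        A_inner_scaleC_right algebra_simps)
  also have "c * cnj c = of_real ((cmod c)\<^sup>2)"
    by (rule complex_norm_square[symmetric])
  finally have "complex_of_real ((A_norm A (x - c *\<^sub>C y))\<^sup>2) = of_real ((A_norm A x)\<^sup>2
      - 2 * Re (cnj c * A_inner A x y) + (cmod c)\<^sup>2 * (A_norm A y)\<^sup>2)"
    unfolding A_inner_self[OF assms] complex_add_cnj by simp
  then show ?thesis
    by (simp only: of_real_eq_iff)
qed

lemma A_Cauchy_Schwarz:
  assumes "positive_op A"
  shows "cmod (A_inner A x y) \<le> A_norm A x * A_norm A y"
proof -
  define z where "z = A_inner A x y"
  \<comment> \<open>Giving the coefficient of y the phase of z turns the cross term into the real
    number t|z|^2, leaving a real quadratic in t.\<close>
  have quad: "0 \<le> (A_norm A x)\<^sup>2 - 2 * t * (cmod z)\<^sup>2 + t\<^sup>2 * (cmod z)\<^sup>2 * (A_norm A y)\<^sup>2" for t :: real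
  proof -
    have "0 \<le> (A_norm A (x - (of_real t * z) *\<^sub>C y))\<^sup>2"
      by simp
    also have "cnj (of_real t * z) * z = of_real (t * (cmod z)\<^sup>2)"
      by (simp add: complex_norm_square[unfolded of_real_power] mult.commute mult.left_commute)
    then have "Re (cnj (of_real t * z) * z) = t * (cmod z)\<^sup>2"
      by (metis Re_complex_of_real)
    then have "(A_norm A (x - (of_real t * z) *\<^sub>C y))\<^sup>2
        = (A_norm A x)\<^sup>2 - 2 * t * (cmod z)\<^sup>2 + t\<^sup>2 * (cmod z)\<^sup>2 * (A_norm A y)\<^sup>2"
      unfolding A_norm_diff_scaleC[OF assms] z_def[symmetric]
      by (simp add: norm_mult power_mult_distrib)
    finally show ?thesis .
  qed
  have "(cmod z)\<^sup>2 \<le> (A_norm A x)\<^sup>2 * (A_norm A y)\<^sup>2"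
  proof (cases "A_norm A y = 0")
    case True
    have "(cmod z)\<^sup>2 = 0"
    proof (rule ccontr)
      assume "(cmod z)\<^sup>2 \<noteq> 0"
      \<comment> \<open>A null vector y of the seminorm leaves only an affine function of t; this
        value of t makes it equal to -1.\<close>
      then show False
        using quad[of "((A_norm A x)\<^sup>2 + 1) / (2 * (cmod z)\<^sup>2)"] True by simp
    qed
    then show ?thesis by simp
  next
    case False
    \<comment> \<open>Here the quadratic is genuine, and it is evaluated at its minimiser
      1/n.\<close>
    define n where "n = (A_norm A y)\<^sup>2"
    have "n > 0"
      using False by (simp add: n_def)
    then have "0 \<le> (A_norm A x)\<^sup>2 - (cmod z)\<^sup>2 / n"
      using quad[of "1 / n", folded n_def] by (simp add: power2_eq_square[of "1 / n"])
    then show ?thesis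
      using \<open>n > 0\<close> by (simp add: n_def[symmetric] field_simps)
  qed
  then show ?thesis
    unfolding z_def[symmetric] power_mult_distrib[symmetric]
    by (rule power2_le_imp_le) (simp add: assms)
qed

lemma A_Buzano:
  assumes "positive_op A" and "A_norm A e = 1"
  shows "2 * cmod (A_inner A a e * A_inner A e b) \<le> A_norm A a * A_norm A b + cmod (A_inner A a b)"
proof -
  define c where "c = 2 * A_inner A a e"
    \<comment> \<open>\<open>a - c *\<^sub>C e\<close> is minus the reflection of \<open>a\<close> in the line spanned by \<open>e\<close>.\<close>
  have "cnj c * A_inner A a e = of_real (2 * (cmod (A_inner A a e))\<^sup>2)"
    by (simp add: c_def complex_norm_square[unfolded of_real_power] mult.commute)
  then have "Re (cnj c * A_inner A a e) = 2 * (cmod (A_inner A a e))\<^sup>2"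
    by (metis Re_complex_of_real)
  then have "(A_norm A (a - c *\<^sub>C e))\<^sup>2 = (A_norm A a)\<^sup>2"
    using assms(2) by (simp add: A_norm_diff_scaleC[OF assms(1)] c_def norm_mult power_mult_distrib)
  then have norm: "A_norm A (a - c *\<^sub>C e) = A_norm A a"
    using assms(1) by simp
  have "2 * cmod (A_inner A a e * A_inner A e b) = cmod (c * A_inner A e b)"
    by (simp add: c_def norm_mult)
  \<comment> \<open>Since ce = a - (a - ce), what remains besides [a,b] is the pairing of b with a
    vector of the same seminorm as a, to which Cauchy-Schwarz applies.\<close>
  also have "c * A_inner A e b = A_inner A a b - A_inner A (a - c *\<^sub>C e) b"
    by (simp add: assms(1) A_inner_diff_left A_inner_scaleC_left)
  also have "cmod \<dots> \<le> cmod (A_inner A a b) + cmod (A_inner A (a - c *\<^sub>C e) b)"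
    by (rule norm_triangle_ineq4)
  also have "cmod (A_inner A (a - c *\<^sub>C e) b) \<le> A_norm A a * A_norm A b"
    using A_Cauchy_Schwarz[OF assms(1), of "a - c *\<^sub>C e" b] norm by simp
  finally show ?thesis by simp
qed

section \<open>Orthogonal projections\<close>

lemma norm_diff_scaleC:
  fixes x :: "'a::complex_inner"
  shows "(norm (x - c *\<^sub>C y))\<^sup>2 = (norm x)\<^sup>2 - 2 * Re (cnj c * cinner x y) + (cmod c)\<^sup>2 * (norm y)\<^sup>2"
  using A_norm_diff_scaleC[OF positive_op_id, of x c y] by (simp add: A_norm_id A_inner_id)

lemma cinner_self: "cinner x x = of_real ((norm (x::'a::complex_inner))\<^sup>2)"
  using A_inner_self[OF positive_op_id, of x] by (simp add: A_norm_id A_inner_id)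

lemma cmod_cinner_le: "cmod (cinner x y) \<le> norm x * norm (y::'a::complex_inner)"
  using A_Cauchy_Schwarz[OF positive_op_id, of x y] by (simp add: A_norm_id A_inner_id)

lemma cinner_left_eq_zero:
  fixes x :: "'a::complex_inner"
  assumes "\<And>y. cinner x y = 0"
  shows "x = 0"
  using assms[of x] by (simp add: cinner_self)

lemma norm_scaleC: "norm (c *\<^sub>C x) = cmod c * norm (x::'a::complex_inner)"
proof -
  have "cinner (c *\<^sub>C x) (c *\<^sub>C x) = (c * cnj c) * cinner x x"
    by (simp add: cinner_scaleC_left cinner_scaleC_right)
  then have "complex_of_real ((norm (c *\<^sub>C x))\<^sup>2) = of_real ((cmod c * norm x)\<^sup>2)"
    unfolding cinner_self by (simp add: complex_norm_square[unfolded of_real_power] power_mult_distrib)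
  then have "(norm (c *\<^sub>C x))\<^sup>2 = (cmod c * norm x)\<^sup>2"
    by (simp only: of_real_eq_iff)
  then show ?thesis
    by simp
qed

lemma bounded_linear_scaleC: "bounded_linear (\<lambda>x::'a::complex_inner. c *\<^sub>C x)"
  by (rule bounded_linear_intro[where K = "cmod c"])
    (simp_all add: scaleC_add_right scaleR_scaleC scaleC_scaleC norm_scaleC mult.commute)

lemma complex_parallelogram_law:
  fixes x y :: "'a::complex_inner"
  shows "(norm (x + y))\<^sup>2 + (norm (x - y))\<^sup>2 = 2 * (norm x)\<^sup>2 + 2 * (norm y)\<^sup>2"
proof -
  have one: "1 *\<^sub>C y = y" "(-1) *\<^sub>C y = - y"
    using scaleR_scaleC[of 1 y] scaleR_scaleC[of "-1" y] by simp_all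
  show ?thesis
    using norm_diff_scaleC[of x 1 y] norm_diff_scaleC[of x "-1" y] by (simp add: one)
qed

text \<open>A minimising sequence for the distance to M is Cauchy by the parallelogram law; its
  limit is a nearest point, and a first-order variation of that point inside M gives
  orthogonality.\<close>

lemma orthogonal_projection_exists:
  fixes M :: "'a::chilbert_space set"
  assumes "closed M" and "M \<noteq> {}"
    and add: "\<And>x y. x \<in> M \<Longrightarrow> y \<in> M \<Longrightarrow> x + y \<in> M"
    and scale: "\<And>c x. x \<in> M \<Longrightarrow> c *\<^sub>C x \<in> M"
  obtains m where "m \<in> M" "\<And>y. y \<in> M \<Longrightarrow> cinner (x - m) y = 0"
proof -
  define d where "d = infdist x M"
  have d_nonneg: "d \<ge> 0"
    by (simp add: d_def infdist_nonneg)
  have d_le: "d \<le> norm (x - y)" if "y \<in> M" for y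
    using infdist_le[OF that, of x] by (simp add: d_def dist_norm)
  have "\<exists>y\<in>M. (norm (x - y))\<^sup>2 < d\<^sup>2 + e" if "e > 0" for e :: real
  proof -
    have "sqrt (d\<^sup>2 + e) > d"
      using that d_nonneg by (intro real_less_rsqrt) auto
    then obtain y where "y \<in> M" "dist x y < sqrt (d\<^sup>2 + e)"
      using assms(2) by (auto simp: d_def infdist_def cINF_less_iff)
    then have "(norm (x - y))\<^sup>2 < (sqrt (d\<^sup>2 + e))\<^sup>2"
      by (intro power_strict_mono) (auto simp: dist_norm)
    then show ?thesis
      using that \<open>y \<in> M\<close> by auto
  qed
  then have "\<forall>n. \<exists>y\<in>M. (norm (x - y))\<^sup>2 < d\<^sup>2 + inverse (Suc n)"
    by simp
  then obtain u where uM: "\<And>n. u n \<in> M"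
    and u: "\<And>n. (norm (x - u n))\<^sup>2 < d\<^sup>2 + inverse (Suc n)"
    by metis
  \<comment> \<open>The midpoint of two terms lies in M, so its distance from x is at least d. The
    parallelogram law for x - u i and x - u j then leaves only the two excesses over d^2.\<close>
  have u_diff: "(norm (u i - u j))\<^sup>2 \<le> 2 * inverse (Suc i) + 2 * inverse (Suc j)" for i j
  proof -
    let ?h = "(1/2) *\<^sub>R (u i + u j)"
    have "?h \<in> M"
      by (simp add: scaleR_scaleC add scale uM)
    then have "d\<^sup>2 \<le> (norm (x - ?h))\<^sup>2"
      using d_le d_nonneg by (simp add: power_mono)
    moreover have "(x - u i) + (x - u j) = 2 *\<^sub>R (x - ?h)"
      by (simp add: algebra_simps scaleR_2)
    moreover have "norm ((x - u i) - (x - u j)) = norm (u i - u j)"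
      by (simp add: norm_minus_commute)
    ultimately show ?thesis
      using complex_parallelogram_law[of "x - u i" "x - u j"] u[of i] u[of j]
      by (simp add: power_mult_distrib)
  qed
  have "Cauchy u"
  proof (rule CauchyI)
    fix e :: real
    assume "e > 0"
    \<comment> \<open>Past N the bound in \<open>u_diff\<close> is at most 4/(N+1), which has to
      stay below e^2.\<close>
    then have "e\<^sup>2 / 4 > 0" by simp
    then obtain N where N: "inverse (Suc N) < e\<^sup>2 / 4"
      using reals_Archimedean by blast
    have "norm (u i - u j) < e" if "i \<ge> N" "j \<ge> N" for i j
    proof -
      have "inverse (Suc i) \<le> inverse (real (Suc N))" "inverse (Suc j) \<le> inverse (real (Suc N))"
        using that by (auto intro!: le_imp_inverse_le)
      then have "(norm (u i - u j))\<^sup>2 < e\<^sup>2"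
        using u_diff[of i j] N by linarith
      then show ?thesis
        using \<open>e > 0\<close> by (simp add: power2_less_imp_less)
    qed
    then show "\<exists>N. \<forall>i\<ge>N. \<forall>j\<ge>N. norm (u i - u j) < e" by blast
  qed
  then obtain m where m: "u \<longlonglongrightarrow> m"
    using Cauchy_convergent convergent_def by blast
  have mM: "m \<in> M"
    using closed_sequentially[OF assms(1)] uM m by blast
  have "(\<lambda>n. (norm (x - u n))\<^sup>2) \<longlonglongrightarrow> (norm (x - m))\<^sup>2"
    by (intro tendsto_intros m)
  moreover have "(\<lambda>n. d\<^sup>2 + inverse (real (Suc n))) \<longlonglongrightarrow> d\<^sup>2 + 0"
    by (intro tendsto_intros LIMSEQ_inverse_real_of_nat)
  ultimately have m_le: "(norm (x - m))\<^sup>2 \<le> d\<^sup>2"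
    using u by (intro LIMSEQ_le[of _ _ _ "d\<^sup>2"]) (auto intro!: exI[of _ 0] less_imp_le)
  have "cinner (x - m) y = 0" if "y \<in> M" for y
  proof -
    define z where "z = cinner (x - m) y"
    \<comment> \<open>The step size makes the quadratic term of the variation at most half the
      linear one; the summand 1 covers y = 0.\<close>
    define t where "t = 1 / ((norm y)\<^sup>2 + 1)"
    have t: "t > 0" "t * (norm y)\<^sup>2 \<le> 1"
      by (auto simp: t_def divide_simps add_nonneg_pos)
    let ?c = "of_real t * z"
    have "m + ?c *\<^sub>C y \<in> M"
      by (simp add: add scale mM that)
    then have "d\<^sup>2 \<le> (norm (x - (m + ?c *\<^sub>C y)))\<^sup>2"
      using d_le d_nonneg by (simp add: power_mono)
    also have "x - (m + ?c *\<^sub>C y) = (x - m) - ?c *\<^sub>C y"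
      by simp
    also have "cnj ?c * z = of_real (t * (cmod z)\<^sup>2)"
      by (simp add: complex_norm_square[unfolded of_real_power] mult.commute mult.left_commute)
    then have "Re (cnj ?c * z) = t * (cmod z)\<^sup>2"
      by (metis Re_complex_of_real)
    then have "(norm ((x - m) - ?c *\<^sub>C y))\<^sup>2
        = (norm (x - m))\<^sup>2 - 2 * (t * (cmod z)\<^sup>2) + t * (cmod z)\<^sup>2 * (t * (norm y)\<^sup>2)"
      unfolding norm_diff_scaleC z_def[symmetric]
      by (simp add: norm_mult power_mult_distrib power2_eq_square)
    finally have "2 * (t * (cmod z)\<^sup>2) \<le> t * (cmod z)\<^sup>2 * (t * (norm y)\<^sup>2)"
      using m_le by simp
    also have "\<dots> \<le> t * (cmod z)\<^sup>2 * 1"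
      using t by (intro mult_left_mono) auto
    finally have "t * (cmod z)\<^sup>2 \<le> 0" by simp
    then have "z = 0"
      using t by (simp add: mult_le_0_iff)
    then show ?thesis by (simp add: z_def)
  qed
  with mM show ?thesis using that by blast
qed

section \<open>The distinguished adjoint\<close>

lemma closure_range_add:
  fixes A :: "'a::complex_inner \<Rightarrow> 'a"
  assumes "bounded_clinear A" "x \<in> closure (range A)" "y \<in> closure (range A)"
  shows "x + y \<in> closure (range A)"
proof -
  obtain u where u: "\<forall>n. u n \<in> range A" "u \<longlonglongrightarrow> x"
    using assms(2) unfolding closure_sequential by blast
  obtain v where v: "\<forall>n. v n \<in> range A" "v \<longlonglongrightarrow> y"
    using assms(3) unfolding closure_sequential by blast
  have "a + b \<in> range A" if "a \<in> range A" "b \<in> range A" for a b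
    using that by (auto simp: bounded_clinear_add[OF assms(1), symmetric])
  then have "\<forall>n. u n + v n \<in> range A"
    using u(1) v(1) by simp
  moreover have "(\<lambda>n. u n + v n) \<longlonglongrightarrow> x + y"
    by (intro tendsto_add u(2) v(2))
  ultimately show ?thesis
    unfolding closure_sequential by (intro exI[of _ "\<lambda>n. u n + v n"] conjI)
qed

lemma closure_range_scaleC:
  fixes A :: "'a::complex_inner \<Rightarrow> 'a"
  assumes "bounded_clinear A" "x \<in> closure (range A)"
  shows "c *\<^sub>C x \<in> closure (range A)"
proof -
  obtain u where u: "\<forall>n. u n \<in> range A" "u \<longlonglongrightarrow> x"
    using assms(2) unfolding closure_sequential by blast
  have "c *\<^sub>C a \<in> range A" if "a \<in> range A" for a
    using that by (auto simp: bounded_clinear_scaleC[OF assms(1), symmetric])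
  then have "\<forall>n. c *\<^sub>C u n \<in> range A"
    using u(1) by simp
  moreover have "(\<lambda>n. c *\<^sub>C u n) \<longlonglongrightarrow> c *\<^sub>C x"
    by (rule bounded_linear.tendsto[OF bounded_linear_scaleC u(2)])
  ultimately show ?thesis
    unfolding closure_sequential by (intro exI[of _ "\<lambda>n. c *\<^sub>C u n"] conjI)
qed

lemma positive_op_selfadjoint:
  assumes "positive_op A"
  shows "cinner (A x) y = cinner x (A y)"
  using A_inner_commute[OF assms, of x y] by (metis A_inner_def cinner_commute)

text \<open>By selfadjointness a vector z of the kernel is orthogonal to the range, so no A y is
  closer to z than 0 is. A nonzero z in the closure would have a closer one.\<close>

lemma kernel_closure_range:
  assumes "positive_op A" and "z \<in> closure (range A)" and "A z = 0"
  shows "z = 0"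
proof (rule ccontr)
  assume "z \<noteq> 0"
  then have "norm z > 0" by simp
  then obtain y where y: "dist (A y) z < norm z"
    using assms(2) unfolding closure_approachable by blast
  have "cinner z (A y) = 0"
    using assms(3) positive_op_selfadjoint[OF assms(1), of z y] cinner_diff_left[of 0 0 y] by simp
  then have "cinner (z - A y) z = of_real ((norm z)\<^sup>2)"
    by (metis cinner_commute cinner_diff_left cinner_self complex_cnj_zero diff_zero)
  then have "(norm z)\<^sup>2 \<le> norm (z - A y) * norm z"
    using cmod_cinner_le[of "z - A y" z] by (simp add: norm_power)
  also have "\<dots> < norm z * norm z"
    using y \<open>norm z > 0\<close> by (simp add: dist_norm norm_minus_commute)
  finally show False
    by (simp add: power2_eq_square)
qed

text \<open>Injectivity of A on the closure of its range. It yields both the linearity and the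
  uniqueness of the distinguished adjoint.\<close>

lemma closure_range_eqI:
  assumes "positive_op A" and "x \<in> closure (range A)" "y \<in> closure (range A)" and "A x = A y"
  shows "x = y"
proof -
  note lin = positive_op_clinear[OF assms(1)]
  have "(-1) *\<^sub>C y = - y"
    using scaleR_scaleC[of "-1" y] by simp
  then have "x - y \<in> closure (range A)"
    using closure_range_add[OF lin assms(2) closure_range_scaleC[OF lin assms(3), of "-1"]] by simp
  then show ?thesis
    using kernel_closure_range[OF assms(1), of "x - y"] assms(4) by (simp add: bounded_clinear_diff lin)
qed

text \<open>Take m to be the orthogonal projection of x: the difference x - m is orthogonal to the
  range of A, hence lies in its kernel. The norm bound later makes the projected adjoint
  bounded.\<close>

lemma projection_closure_range:
  fixes A :: "'a::chilbert_space \<Rightarrow> 'a"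
  assumes "positive_op A"
  obtains m where "m \<in> closure (range A)" "A m = A x" "norm m \<le> norm x"
proof -
  note lin = positive_op_clinear[OF assms]
  obtain m where m: "m \<in> closure (range A)" "\<And>y. y \<in> closure (range A) \<Longrightarrow> cinner (x - m) y = 0"
  proof (rule orthogonal_projection_exists[of "closure (range A)" x])
  qed (auto intro: closure_range_add[OF lin] closure_range_scaleC[OF lin])
  have "cinner (A (x - m)) y = 0" for y
    using m(2)[of "A y"] closure_subset[of "range A"] by (auto simp: positive_op_selfadjoint[OF assms])
  then have "A (x - m) = 0"
    by (rule cinner_left_eq_zero)
  then have "A m = A x"
    by (simp add: bounded_clinear_diff lin)
  moreover have "cinner x m = of_real ((norm m)\<^sup>2)"
    using m(2)[OF m(1)] by (simp add: cinner_diff_left cinner_self)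
  then have "norm m * norm m \<le> norm x * norm m"
    using cmod_cinner_le[of x m] by (simp add: norm_mult power2_eq_square)
  then have "norm m \<le> norm x"
    by (cases "m = 0") auto
  ultimately show ?thesis
    using that m(1) by blast
qed

text \<open>The A-adjoints of T agree modulo the kernel of A. Thus an A-adjoint may be projected
  pointwise, and two of them with values in the closure of the range coincide.\<close>

lemma is_A_adjoint_iff_eq:
  assumes "positive_op A" and "is_A_adjoint A T R" and "bounded_clinear S"
  shows "is_A_adjoint A T S \<longleftrightarrow> (\<forall>y. A (S y) = A (R y))"
proof
  assume S: "is_A_adjoint A T S"
  show "\<forall>y. A (S y) = A (R y)"
  proof
    fix y
    have "cinner (A (S y) - A (R y)) x = 0" for x
    proof -
      have "cinner x (A (S y)) = cinner x (A (R y))"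
        using S assms(2) by (simp add: is_A_adjoint_def A_inner_def positive_op_selfadjoint[OF assms(1), symmetric])
      then show ?thesis
        by (metis cinner_commute cinner_diff_left diff_self)
    qed
    then have "A (S y) - A (R y) = 0"
      by (rule cinner_left_eq_zero)
    then show "A (S y) = A (R y)" by simp
  qed
next
  assume "\<forall>y. A (S y) = A (R y)"
  then show "is_A_adjoint A T S"
    using assms(2,3) by (simp add: is_A_adjoint_def A_inner_def positive_op_selfadjoint[OF assms(1)])
qed

text \<open>The definite description in \<open>A_sharp\<close> carries information only after
  existence and uniqueness are known; both are established here.\<close>

lemma is_A_adjoint_A_sharp:
  fixes A :: "'a::chilbert_space \<Rightarrow> 'a"
  assumes "positive_op A" and "T \<in> A_adjointable A"
  shows "is_A_adjoint A T (A_sharp A T)"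
proof -
  note lin = positive_op_clinear[OF assms(1)]
  obtain R where R: "is_A_adjoint A T R"
    using assms(2) by (auto simp: A_adjointable_def)
  then have Rlin: "bounded_clinear R"
    by (simp add: is_A_adjoint_def)
  have "\<forall>x. \<exists>m. m \<in> closure (range A) \<and> A m = A (R x) \<and> norm m \<le> norm (R x)"
    using projection_closure_range[OF assms(1)] by metis
  then obtain S where S: "\<And>x. S x \<in> closure (range A)" "\<And>x. A (S x) = A (R x)"
    "\<And>x. norm (S x) \<le> norm (R x)"
    by metis
  \<comment> \<open>S is chosen pointwise, so its linearity has to be recovered: both sides lie in
    the closure of the range and have the same image under A, because R is linear.\<close>
  have Sadd: "S (x + y) = S x + S y" for x y
    by (rule closure_range_eqI[OF assms(1)])
      (simp_all add: S closure_range_add lin Rlin bounded_clinear_add)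
  have Sscale: "S (c *\<^sub>C x) = c *\<^sub>C S x" for c x
    by (rule closure_range_eqI[OF assms(1)])
      (simp_all add: S closure_range_scaleC lin Rlin bounded_clinear_scaleC)
  obtain K where K: "\<And>x. norm (R x) \<le> norm x * K"
    using Rlin bounded_linear.bounded unfolding bounded_clinear_def by blast
  have "bounded_linear S"
    by (rule bounded_linear_intro[where K = K])
      (auto simp: Sadd Sscale scaleR_scaleC intro: order_trans[OF S(3) K])
  then have Slin: "bounded_clinear S"
    by (simp add: bounded_clinear_def Sscale)
  have "is_A_adjoint A T S \<and> range S \<subseteq> closure (range A)"
    using S is_A_adjoint_iff_eq[OF assms(1) R Slin] by auto
  moreover have "S' = S" if "is_A_adjoint A T S' \<and> range S' \<subseteq> closure (range A)" for S'
  proof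
    fix x
    have "bounded_clinear S'"
      using that by (simp add: is_A_adjoint_def)
    then have "A (S' x) = A (R x)"
      using that is_A_adjoint_iff_eq[OF assms(1) R] by blast
    then show "S' x = S x"
      using that S by (metis closure_range_eqI[OF assms(1)] range_subsetD)
  qed
  ultimately have "is_A_adjoint A T (A_sharp A T) \<and> range (A_sharp A T) \<subseteq> closure (range A)"
    unfolding A_sharp_def by (rule theI)
  then show ?thesis ..
qed

section \<open>Boundedness for the seminorm\<close>

lemma A_norm_le_norm:
  assumes "positive_op A"
  obtains M where "M \<ge> 0" "\<And>x. A_norm A x \<le> M * norm x"
proof -
  have "bounded_linear A"
    using assms by (simp add: positive_op_def bounded_clinear_def)
  then obtain K where K: "K \<ge> 0" "\<And>x. norm (A x) \<le> norm x * K"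
    using bounded_linear.nonneg_bounded by blast
  have "A_norm A x \<le> sqrt K * norm x" for x
  proof -
    have "Re (A_inner A x x) \<le> cmod (cinner (A x) x)"
      by (simp add: A_inner_def complex_Re_le_cmod)
    also have "\<dots> \<le> norm (A x) * norm x"
      by (rule cmod_cinner_le)
    also have "\<dots> \<le> (norm x * K) * norm x"
      by (intro mult_right_mono K) simp
    finally have "A_norm A x \<le> sqrt (K * (norm x)\<^sup>2)"
      unfolding A_norm_def by (simp add: power2_eq_square mult_ac)
    then show ?thesis
      by (simp add: real_sqrt_mult)
  qed
  then show ?thesis
    using that[of "sqrt K"] K(1) by simp
qed

text \<open>Hermitian symmetry lets T and S exchange roles, so each fact about ST also holds for
  TS.\<close>

lemma is_A_adjoint_sym:
  assumes "positive_op A" "bounded_clinear T" "is_A_adjoint A T S"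
  shows "is_A_adjoint A S T"
  using assms A_inner_commute unfolding is_A_adjoint_def by metis

lemma is_A_adjoint_inner:
  "is_A_adjoint A T S \<Longrightarrow> A_inner A (T x) y = A_inner A x (S y)"
  by (simp add: is_A_adjoint_def)

text \<open>Iterating $\|Bx\|_A^2 = [B^2x,x] \le \|B^2x\|_A$ for $\|x\|_A = 1$ gives
  $\|Bx\|_A^{2^n} \le \|B^{2^n}x\|_A$, whose right-hand side is $O(\|B\|^{2^n})$.\<close>

lemma A_selfadjoint_A_bounded:
  assumes A: "positive_op A" and B: "is_A_adjoint A B B"
  obtains K where "K > 0" "\<And>x. A_norm A x = 1 \<Longrightarrow> A_norm A (B x) \<le> K"
proof -
  have "bounded_linear B"
    using B by (simp add: is_A_adjoint_def bounded_clinear_def)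
  then obtain K where K: "K > 0" "\<And>x. norm (B x) \<le> norm x * K"
    using bounded_linear.pos_bounded by blast
  have pow_bound: "norm ((B ^^ n) x) \<le> K ^ n * norm x" for n x
  proof (induction n)
    case (Suc n)
    have "norm ((B ^^ Suc n) x) \<le> norm ((B ^^ n) x) * K"
      using K(2) by simp
    also have "\<dots> \<le> (K ^ n * norm x) * K"
      using Suc K(1) by (intro mult_right_mono) auto
    finally show ?case by (simp add: mult_ac)
  qed simp
  obtain M where M: "M \<ge> 0" "\<And>x. A_norm A x \<le> M * norm x"
    using A_norm_le_norm[OF A] by blast
  have adj: "A_inner A ((B ^^ n) x) y = A_inner A x ((B ^^ n) y)" for n x y
    by (induction n arbitrary: x) (simp_all add: is_A_adjoint_inner[OF B] funpow_swap1)
  have "A_norm A (B x) \<le> K" if x: "A_norm A x = 1" for x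
  proof (rule ccontr)
    assume "\<not> A_norm A (B x) \<le> K"
    then have gt: "A_norm A (B x) / K > 1"
      using K(1) by simp
    have sq: "(A_norm A ((B ^^ n) x))\<^sup>2 \<le> A_norm A ((B ^^ (2 * n)) x)" for n
    proof -
      have self: "A_inner A ((B ^^ n) x) ((B ^^ n) x) = A_inner A x ((B ^^ (2 * n)) x)"
        by (simp add: adj mult_2 funpow_add)
      then have "(A_norm A ((B ^^ n) x))\<^sup>2 = cmod (A_inner A x ((B ^^ (2 * n)) x))"
        by (simp add: A_inner_self[OF A] norm_power flip: self)
      also have "\<dots> \<le> A_norm A x * A_norm A ((B ^^ (2 * n)) x)"
        by (rule A_Cauchy_Schwarz[OF A])
      finally show ?thesis by (simp add: x)
    qed
    have iter: "A_norm A (B x) ^ (2 ^ n) \<le> A_norm A ((B ^^ (2 ^ n)) x)" for n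
    proof (induction n)
      case (Suc n)
      have "A_norm A (B x) ^ (2 ^ Suc n) = (A_norm A (B x) ^ (2 ^ n))\<^sup>2"
        by (simp add: power_mult[symmetric] mult.commute)
      also have "\<dots> \<le> (A_norm A ((B ^^ (2 ^ n)) x))\<^sup>2"
        using Suc A by (intro power_mono) auto
      also have "\<dots> \<le> A_norm A ((B ^^ (2 ^ Suc n)) x)"
        using sq[of "2 ^ n"] by simp
      finally show ?case .
    qed simp
    have bound: "(A_norm A (B x) / K) ^ (2 ^ n) \<le> M * norm x" for n
    proof -
      have "A_norm A (B x) ^ (2 ^ n) \<le> M * norm ((B ^^ (2 ^ n)) x)"
        using iter M(2) order_trans by blast
      also have "\<dots> \<le> M * (K ^ (2 ^ n) * norm x)"
        using pow_bound M(1) by (intro mult_left_mono) auto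
      finally show ?thesis
        using K(1) by (simp add: power_divide field_simps)
    qed
    \<comment> \<open>The bound depends on x but not on n, while powers of a ratio above 1 are
      unbounded. Hence K serves the whole sphere. Passing from exponent n to 2^n only enlarges the
      power.\<close>
    obtain n where n: "M * norm x < (A_norm A (B x) / K) ^ n"
      using real_arch_pow[OF gt] by blast
    also have "\<dots> \<le> (A_norm A (B x) / K) ^ (2 ^ n)"
      using gt by (intro power_increasing) (auto intro: less_imp_le)
    finally show False
      using bound[of n] by simp
  qed
  then show ?thesis
    using that K(1) by blast
qed

lemma A_adjoint_compose_selfadjoint:
  assumes "positive_op A" "bounded_clinear T" "is_A_adjoint A T S"
  shows "is_A_adjoint A (\<lambda>x. S (T x)) (\<lambda>x. S (T x))"
proof -
  note S = is_A_adjoint_sym[OF assms]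
  have "bounded_clinear S"
    using assms(3) by (simp add: is_A_adjoint_def)
  then show ?thesis
    using assms(2) is_A_adjoint_inner[OF assms(3)] is_A_adjoint_inner[OF S]
    by (simp add: is_A_adjoint_def bounded_clinear_compose)
qed

lemma A_norm_adjoint_square:
  assumes "positive_op A" "bounded_clinear T" "is_A_adjoint A T S"
  shows "A_inner A (S (T x)) x = of_real ((A_norm A (T x))\<^sup>2)"
  using is_A_adjoint_inner[OF is_A_adjoint_sym[OF assms]] A_inner_self[OF assms(1)] by metis

text \<open>On the A-sphere the squared seminorm of Tx is [STx,x], at most the seminorm of STx, and
  ST is its own A-adjoint, so the previous bound applies to it.\<close>

lemma A_adjoint_A_bounded:
  assumes "positive_op A" "bounded_clinear T" "is_A_adjoint A T S"
  obtains K where "\<And>x. A_norm A x = 1 \<Longrightarrow> A_norm A (T x) \<le> K"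
proof -
  obtain K where K: "\<And>x. A_norm A x = 1 \<Longrightarrow> A_norm A (S (T x)) \<le> K"
    using A_selfadjoint_A_bounded[OF assms(1) A_adjoint_compose_selfadjoint[OF assms]] by blast
  have "A_norm A (T x) \<le> sqrt K" if x: "A_norm A x = 1" for x
  proof -
    have "(A_norm A (T x))\<^sup>2 = cmod (A_inner A (S (T x)) x)"
      by (simp add: A_norm_adjoint_square[OF assms] norm_power)
    also have "\<dots> \<le> A_norm A (S (T x)) * A_norm A x"
      by (rule A_Cauchy_Schwarz[OF assms(1)])
    finally show ?thesis
      using K[OF x] x by (intro real_le_rsqrt) simp
  qed
  then show ?thesis using that by blast
qed

text \<open>The supremum dominates its members only if the set is bounded above, which
  Cauchy-Schwarz and the seminorm bound for T supply.\<close>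

lemma A_inner_le_numradius:
  assumes "positive_op A" "bounded_clinear T" "is_A_adjoint A T S" "A_norm A x = 1"
  shows "cmod (A_inner A (T x) x) \<le> A_numradius A T"
proof -
  obtain K where K: "\<And>x. A_norm A x = 1 \<Longrightarrow> A_norm A (T x) \<le> K"
    using A_adjoint_A_bounded[OF assms(1-3)] by blast
  have "cmod (A_inner A (T y) y) \<le> K" if "A_norm A y = 1" for y
    using A_Cauchy_Schwarz[OF assms(1), of "T y" y] K[OF that] that by simp
  then have "bdd_above ((\<lambda>y. cmod (A_inner A (T y) y)) ` A_sphere A)"
    by (auto simp: A_sphere_def bdd_above_def)
  then have "cmod (A_inner A (T x) x) \<le> (SUP y\<in>A_sphere A. cmod (A_inner A (T y) y))"
    by (rule cSUP_upper[rotated]) (simp add: A_sphere_def assms(4))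
  then show ?thesis
    using assms(4) by (auto simp: A_numradius_def A_sphere_def)
qed

lemma A_inner_le_opnorm:
  assumes "positive_op A" "bounded_clinear T" "is_A_adjoint A T S" "A_norm A x = 1"
  shows "cmod (A_inner A (T x) x) \<le> A_opnorm A T"
proof -
  obtain K where K: "\<And>x. A_norm A x = 1 \<Longrightarrow> A_norm A (T x) \<le> K"
    using A_adjoint_A_bounded[OF assms(1-3)] by blast
  then have "bdd_above ((\<lambda>y. A_norm A (T y)) ` A_sphere A)"
    by (auto simp: A_sphere_def bdd_above_def)
  then have "A_norm A (T x) \<le> (SUP y\<in>A_sphere A. A_norm A (T y))"
    by (rule cSUP_upper[rotated]) (simp add: A_sphere_def assms(4))
  then have "A_norm A (T x) \<le> A_opnorm A T"
    using assms(4) by (auto simp: A_opnorm_def A_sphere_def)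
  then show ?thesis
    using A_Cauchy_Schwarz[OF assms(1), of "T x" x] assms(4) by simp
qed

section \<open>The numerical radius bounds\<close>

lemma is_A_adjoint_combination:
  assumes "positive_op A" "is_A_adjoint A P P'" "is_A_adjoint A Q Q'"
  shows "is_A_adjoint A (\<lambda>x. a *\<^sub>R P x + b *\<^sub>R Q x) (\<lambda>x. a *\<^sub>R P' x + b *\<^sub>R Q' x)"
  using assms
  by (auto simp: is_A_adjoint_def bounded_clinear_def scaleR_scaleC scaleC_add_right scaleC_scaleC
      A_inner_add_left A_inner_add_right A_inner_scaleC_left A_inner_scaleC_right mult.commute
      intro!: bounded_linear_add bounded_linear_compose[OF bounded_linear_scaleC])

lemma A_inner_square_le:
  assumes A: "positive_op A" and S: "is_A_adjoint A T S"
    and x: "A_norm A x = 1" and \<alpha>: "0 \<le> \<alpha>" "\<alpha> \<le> 1"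
    and ab: "a = \<alpha> / 4 \<and> b = 1 - 3 * \<alpha> / 4 \<or> a = 1 - 3 * \<alpha> / 4 \<and> b = \<alpha> / 4"
  shows "(cmod (A_inner A (T x) x))\<^sup>2 \<le> \<alpha> / 2 * cmod (A_inner A (T (T x)) x)
    + (a * (A_norm A (S x))\<^sup>2 + b * (A_norm A (T x))\<^sup>2)"
proof -
  define w where "w = (cmod (A_inner A (T x) x))\<^sup>2"
  define t where "t = (A_norm A (T x))\<^sup>2"
  define s where "s = (A_norm A (S x))\<^sup>2"
  define m where "m = cmod (A_inner A (T (T x)) x)"
  note adj = is_A_adjoint_inner[OF S]
  define p where "p = A_norm A (T x) * A_norm A (S x)"
  \<comment> \<open>Moving S across gives [x,Sx] = [Tx,x] and [Tx,Sx] = [TTx,x], so the product in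
    Buzano's inequality is a square.\<close>
  have "2 * w \<le> p + m"
    using A_Buzano[OF A x, of "T x" "S x"]
    by (simp add: w_def m_def p_def adj[symmetric] power2_eq_square norm_mult)
  moreover have "2 * p \<le> t + s"
    using sum_squares_bound[of "A_norm A (T x)" "A_norm A (S x)"]
    by (simp add: t_def s_def p_def mult.assoc)
  ultimately have buzano: "w \<le> m / 2 + (t + s) / 4"
    by (simp add: field_simps)
  have "cmod (A_inner A (T x) x) \<le> A_norm A (T x)" "cmod (A_inner A (T x) x) \<le> A_norm A (S x)"
    using A_Cauchy_Schwarz[OF A, of "T x" x] A_Cauchy_Schwarz[OF A, of x "S x"] x
    by (simp_all add: adj)
  then have "w \<le> t" "w \<le> s"
    unfolding w_def t_def s_def by (auto intro!: power_mono)
  \<comment> \<open>Weight \<alpha> goes to the Buzano estimate and 1 - \<alpha> to Cauchy-Schwarz.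
    With c = t or c = s, that term gets the total coefficient \<alpha>/4 + (1 - \<alpha>) = 1 -
    3\<alpha>/4.\<close>
  have est: "w \<le> \<alpha> / 2 * m + \<alpha> / 4 * (t + s) + (1 - \<alpha>) * c" if "w \<le> c" for c
  proof -
    have "\<alpha> * w + (1 - \<alpha>) * w \<le> \<alpha> * (m / 2 + (t + s) / 4) + (1 - \<alpha>) * c"
      using \<alpha> buzano that by (intro add_mono mult_left_mono) auto
    then show ?thesis
      by (simp add: algebra_simps)
  qed
  from ab have "w \<le> \<alpha> / 2 * m + (a * s + b * t)"
  proof (elim disjE conjE)
    assume eq: "a = \<alpha> / 4" "b = 1 - 3 * \<alpha> / 4"
    show ?thesis
      unfolding eq using est[OF \<open>w \<le> t\<close>] by (simp add: field_simps)
  next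
    assume eq: "a = 1 - 3 * \<alpha> / 4" "b = \<alpha> / 4"
    show ?thesis
      unfolding eq using est[OF \<open>w \<le> s\<close>] by (simp add: field_simps)
  qed
  then show ?thesis
    by (simp add: w_def t_def s_def m_def)
qed

text \<open>Any A-adjoint S works: its range is irrelevant to the inequality.\<close>

lemma numradius_square_le:
  assumes A: "positive_op A" and T: "bounded_clinear T" and S: "is_A_adjoint A T S"
    and \<alpha>: "0 \<le> \<alpha>" "\<alpha> \<le> 1"
    and ab: "a = \<alpha> / 4 \<and> b = 1 - 3 * \<alpha> / 4 \<or> a = 1 - 3 * \<alpha> / 4 \<and> b = \<alpha> / 4"
  shows "(A_numradius A T)\<^sup>2 \<le> \<alpha> / 2 * A_numradius A (T \<circ> T)
    + A_opnorm A (\<lambda>x. a *\<^sub>R (T \<circ> S) x + b *\<^sub>R (S \<circ> T) x)"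
proof (cases "A_sphere A = {}")
  \<comment> \<open>Over an empty sphere all three quantities are 0 by convention.\<close>
  case True
  then show ?thesis
    by (simp add: A_numradius_def A_opnorm_def)
next
  case False
  let ?C = "\<lambda>x. a *\<^sub>R (T \<circ> S) x + b *\<^sub>R (S \<circ> T) x"
  let ?r = "\<alpha> / 2 * A_numradius A (T \<circ> T) + A_opnorm A ?C"
  have S': "is_A_adjoint A S T" and Slin: "bounded_clinear S"
    using S is_A_adjoint_sym[OF A T S] by (auto simp: is_A_adjoint_def)
  have TT: "is_A_adjoint A (T \<circ> T) (S \<circ> S)" "bounded_clinear (T \<circ> T)"
    using S T Slin by (simp_all add: is_A_adjoint_def bounded_clinear_compose o_def)
  have C: "is_A_adjoint A ?C ?C"
    using is_A_adjoint_combination[OF A A_adjoint_compose_selfadjoint[OF A Slin S']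
        A_adjoint_compose_selfadjoint[OF A T S]] by simp
  then have Clin: "bounded_clinear ?C"
    by (simp add: is_A_adjoint_def)
  have le: "(cmod (A_inner A (T x) x))\<^sup>2 \<le> ?r" if x: "A_norm A x = 1" for x
  proof -
    have nonneg: "a \<ge> 0" "b \<ge> 0"
      using ab \<alpha> by auto
    \<comment> \<open>The quadratic form of \<open>?C\<close> is the weighted sum from the pointwise
      estimate. It is real and nonnegative, so it equals its modulus and is bounded by the operator
      seminorm.\<close>
    have "A_inner A (?C x) x = of_real (a * (A_norm A (S x))\<^sup>2 + b * (A_norm A (T x))\<^sup>2)"
      using A_norm_adjoint_square[OF A Slin S'] A_norm_adjoint_square[OF A T S]
      by (simp add: A A_inner_add_left A_inner_scaleR_left)
    then have "cmod (A_inner A (?C x) x) = a * (A_norm A (S x))\<^sup>2 + b * (A_norm A (T x))\<^sup>2"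
      using nonneg by (simp only: norm_of_real) simp
    then have op: "a * (A_norm A (S x))\<^sup>2 + b * (A_norm A (T x))\<^sup>2 \<le> A_opnorm A ?C"
      using A_inner_le_opnorm[OF A Clin C x] by simp
    have "cmod (A_inner A (T (T x)) x) \<le> A_numradius A (T \<circ> T)"
      using A_inner_le_numradius[OF A TT(2,1) x] by simp
    then have "\<alpha> / 2 * cmod (A_inner A (T (T x)) x) \<le> \<alpha> / 2 * A_numradius A (T \<circ> T)"
      using \<alpha> by (intro mult_left_mono) auto
    with op show ?thesis
      using A_inner_square_le[OF A S x \<alpha> ab] by linarith
  qed
  \<comment> \<open>One point of the sphere shows that the radius and \<open>?r\<close> are
    nonnegative, as needed to square the bound by \<open>sqrt ?r\<close>.\<close>
  obtain x where "x \<in> A_sphere A"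
    using False by blast
  then have x: "A_norm A x = 1"
    by (simp add: A_sphere_def)
  have "(SUP x\<in>A_sphere A. cmod (A_inner A (T x) x)) \<le> sqrt ?r"
    by (rule cSUP_least[OF False], rule real_le_rsqrt, rule le) (simp add: A_sphere_def)
  then have "A_numradius A T \<le> sqrt ?r"
    using False by (simp add: A_numradius_def[of A T])
  moreover have "0 \<le> A_numradius A T"
    using A_inner_le_numradius[OF A T S x] norm_ge_zero order_trans by blast
  moreover have "0 \<le> ?r"
    using le[OF x] zero_le_power2 order_trans by blast
  ultimately show ?thesis
    by (metis power_mono real_sqrt_pow2)
qed

theorem theorem2p6:
  fixes A T :: "'a::chilbert_space \<Rightarrow> 'a" and \<alpha> :: real
  assumes "positive_op A" and "T \<in> A_adjointable A" and "\<alpha> \<in> {0..1}"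
  shows "(A_numradius A T)\<^sup>2 \<le> \<alpha> / 2 * A_numradius A (T \<circ> T)
           + A_opnorm A (\<lambda>x. (\<alpha> / 4) *\<^sub>R (T \<circ> A_sharp A T) x
                           + (1 - 3 * \<alpha> / 4) *\<^sub>R (A_sharp A T \<circ> T) x)
       \<and> (A_numradius A T)\<^sup>2 \<le> \<alpha> / 2 * A_numradius A (T \<circ> T)
           + A_opnorm A (\<lambda>x. (1 - 3 * \<alpha> / 4) *\<^sub>R (T \<circ> A_sharp A T) x
                           + (\<alpha> / 4) *\<^sub>R (A_sharp A T \<circ> T) x)"
proof -
  have "bounded_clinear T"
    using assms(2) by (simp add: A_adjointable_def)
  then show ?thesis
    using assms(3) by (intro conjI numradius_square_le[OF assms(1) _ is_A_adjoint_A_sharp[OF assms(1,2)]]) auto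
qed

end
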